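(* Let $n\ge 3$ and $k\ge 3$ be fixed integers. Then, for all integers $m\ge 0$, $$\nu_k(K_n)\ \ge\ \frac{m}{2}\,n(n-3)-k\sum_{\ell=0}^{m-1}e_\ell(n).$$
   Context: A $k$-page book consists of $k$ halfplanes (pages) with a common boundary line (the spine). A $k$-page book drawing of a graph $G$ is a drawing of $G$ in a $k$-page book in which all vertices lie on the spine and edges do not cross the spine (each edge lies in one page). The $k$-page book crossing number $\nu_k(G)$ is the minimum number of edge-crossings over all $k$-page book drawings of $G$. Equivalently (convex model), $\nu_k(K_n)$ is the minimum, over all colorings of the edges of the complete geometric graph on the $n$ vertices of a convex polygon with $k$ colors, of the number of monochromatic crossings, i.e. pairs of edges of the same color that cross in their interiors. $K_n$ is the complete graph on $n$ vertices. $D_n$ denotes the complete convex graph on $n$ vertices minus the sides of the polygon: its vertices are the vertices of a convex $n$-gon and its edges are all the diagonals (straight segments) of the polygon. For an integer $\ell\ge 0$, $e_\ell(n)$ is the maximum number of edges over all subgraphs of $D_n$ in which each edge is crossed at most $\ell$ times by other edges of the subgraph. *)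

theory Defs
  imports "HOL-Analysis.Analysis"
begin

text \<open>
  A simple graph is given by its vertex set \<open>V\<close> and a set \<open>E\<close> of two-element subsets of \<open>V\<close>.
\<close>

definition complete_edges :: "'a set \<Rightarrow> 'a set set" where
  "complete_edges V = {e. e \<subseteq> V \<and> card e = 2}"


text \<open>
  Every page of a book is a copy of the closed upper half-plane, numbered by \<open>i < k\<close>; all copies
  are glued along the spine. A drawing places the vertices on the spine by \<open>pos\<close>, and draws each
  edge \<open>e\<close> as the simple arc \<open>\<gamma> e\<close> in page \<open>pg e\<close>. Since the interiors of the arcs stay off
  the spine, two edges in different pages have no common interior points.
\<close>

definition spine :: "(real^2) set" where
  "spine = {z. z $ 2 = 0}"

definition open_page :: "(real^2) set" where
  "open_page = {z. z $ 2 > 0}"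

definition arc_interior :: "(real \<Rightarrow> real^2) \<Rightarrow> (real^2) set" where
  "arc_interior g = path_image g - {pathstart g, pathfinish g}"

text \<open>
  A crossing is an unordered pair of distinct edges together with a common interior point, so a
  pair of edges may contribute several crossings, and a point lying on \<open>r\<close> edges counts
  \<open>r choose 2\<close> times. Finiteness of the set of crossings is part of the notion of a drawing;
  in particular edges do not overlap, and \<^const>\<open>card\<close> below is the true count.
\<close>

definition drawing_crossings ::
  "'a set set \<Rightarrow> ('a set \<Rightarrow> nat) \<Rightarrow> ('a set \<Rightarrow> real \<Rightarrow> real^2) \<Rightarrow> ('a set set \<times> (real^2)) set" where
  "drawing_crossings E pg \<gamma> =
     {({e, f}, z) | e f z. e \<in> E \<and> f \<in> E \<and> e \<noteq> f \<and> pg e = pg f \<and>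
                           z \<in> arc_interior (\<gamma> e) \<inter> arc_interior (\<gamma> f)}"

definition book_drawing ::
  "nat \<Rightarrow> 'a set \<Rightarrow> 'a set set \<Rightarrow> ('a \<Rightarrow> real^2) \<Rightarrow> ('a set \<Rightarrow> nat) \<Rightarrow>
   ('a set \<Rightarrow> real \<Rightarrow> real^2) \<Rightarrow> bool" where
  "book_drawing k V E pos pg \<gamma> \<longleftrightarrow>
     inj_on pos V \<and> pos ` V \<subseteq> spine \<and>
     (\<forall>e\<in>E. pg e < k \<and> arc (\<gamma> e) \<and> {pathstart (\<gamma> e), pathfinish (\<gamma> e)} = pos ` e \<and>
             arc_interior (\<gamma> e) \<subseteq> open_page) \<and>
     finite (drawing_crossings E pg \<gamma>)"

text \<open>
  On \<^typ>\<open>nat\<close>, \<^const>\<open>Inf\<close> of a nonempty set is its minimum; every finite graph has a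
  \<open>k\<close>-page book drawing when \<open>k > 0\<close>.
\<close>

definition book_crossing_number :: "nat \<Rightarrow> 'a set \<Rightarrow> 'a set set \<Rightarrow> nat" where
  "book_crossing_number k V E =
     Inf {card (drawing_crossings E pg \<gamma>) | pos pg \<gamma>. book_drawing k V E pos pg \<gamma>}"


definition convex_polygon_vertices :: "nat \<Rightarrow> (real^2) set \<Rightarrow> bool" where
  "convex_polygon_vertices n P \<longleftrightarrow>
     finite P \<and> card P = n \<and> (\<forall>p\<in>P. p extreme_point_of (convex hull P))"

text \<open>
  The edges of the complete convex graph on \<open>P\<close> minus the sides of the polygon. An edge is
  represented by the set of its two endpoints.
\<close>

definition polygon_diagonals :: "(real^2) set \<Rightarrow> (real^2) set set" where
  "polygon_diagonals P =
     {{u, v} | u v. u \<in> P \<and> v \<in> P \<and> u \<noteq> v \<and> \<not> (closed_segment u v edge_of (convex hull P))}"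

definition segments_cross :: "(real^2) set \<Rightarrow> (real^2) set \<Rightarrow> bool" where
  "segments_cross e f \<longleftrightarrow> e \<noteq> f \<and>
     (\<exists>a b c d. e = {a, b} \<and> f = {c, d} \<and> open_segment a b \<inter> open_segment c d \<noteq> {})"

text \<open>
  The maximum does not depend on the choice of the convex polygon, so it is taken over all convex
  \<open>n\<close>-gons at once.
\<close>

definition max_edges :: "nat \<Rightarrow> nat \<Rightarrow> nat" where
  "max_edges l n =
     Max {card F | F P. convex_polygon_vertices n P \<and> F \<subseteq> polygon_diagonals P \<and>
                        (\<forall>e\<in>F. card {f \<in> F. segments_cross e f} \<le> l)}"

end

theory Submission
  imports Defs
begin

text \<open>
  In a set of edges with more than \<open>e\<^sub>l(n)\<close> diagonals some edge is crossed more than \<open>l\<close> times;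
  deleting such edges one at a time shows that \<open>N\<close> diagonals have at least
  \<open>\<Sum>l<m. N - e\<^sub>l(n)\<close> crossings, for every \<open>m\<close>. Given a book drawing, lift the vertices from the
  spine to the parabola \<open>y = x\<^sup>2\<close>, where they become a convex \<open>n\<close>-gon. Chords cross exactly when
  their endpoints interlace, and then arcs in one half-plane with these endpoints meet
  by the Fashoda theorem. Summing the bound over the \<open>k\<close> pages, which together
  contain all the (at least) \<open>n(n-3)/2\<close> diagonals, gives the theorem.
\<close>

section \<open>Crossings forced by degree bounds\<close>

text \<open>Pairs are unordered sets, as in the first component of \<open>drawing_crossings\<close>,
  so that a crossing pair of edges is counted once.\<close>

definition related_pairs :: "('a \<Rightarrow> 'a \<Rightarrow> bool) \<Rightarrow> 'a set \<Rightarrow> 'a set set" where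
  "related_pairs R F = {{e, f} | e f. e \<in> F \<and> f \<in> F \<and> R e f}"

lemma finite_related_pairs: "finite F \<Longrightarrow> finite (related_pairs R F)"
  by (rule finite_subset[of _ "Pow F"]) (auto simp: related_pairs_def)

text \<open>The pairs \<open>{e, f}\<close> with \<open>R e f\<close> correspond bijectively to the
  neighbours \<open>f\<close> of \<open>e\<close>, and none of them survives the deletion of
  \<open>e\<close>. Only an inequality results, since \<open>R\<close> is not assumed
  symmetric.\<close>

lemma card_related_pairs_remove:
  assumes "finite F" "e \<in> F"
  shows "card (related_pairs R (F - {e})) + card {f \<in> F. R e f} \<le> card (related_pairs R F)"
proof -
  let ?N = "{f \<in> F. R e f}"
  have "inj_on (\<lambda>f. {e, f}) ?N"
    by (auto simp: inj_on_def doubleton_eq_iff)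
  then have "card ((\<lambda>f. {e, f}) ` ?N) = card ?N"
    by (rule card_image)
  moreover have "related_pairs R (F - {e}) \<inter> (\<lambda>f. {e, f}) ` ?N = {}"
  proof -
    have "e \<notin> p" if "p \<in> related_pairs R (F - {e})" for p
      using that unfolding related_pairs_def by blast
    then show ?thesis by blast
  qed
  ultimately have card_Un: "card (related_pairs R (F - {e}) \<union> (\<lambda>f. {e, f}) ` ?N)
      = card (related_pairs R (F - {e})) + card ?N"
    using assms by (subst card_Un_disjoint) (auto intro: finite_related_pairs)
  have "related_pairs R (F - {e}) \<union> (\<lambda>f. {e, f}) ` ?N \<subseteq> related_pairs R F"
  proof (rule Un_least)
    show "related_pairs R (F - {e}) \<subseteq> related_pairs R F"
      unfolding related_pairs_def by (rule Collect_mono) (metis DiffD1)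
    show "(\<lambda>f. {e, f}) ` ?N \<subseteq> related_pairs R F"
      unfolding related_pairs_def image_subset_iff using assms(2) by fast
  qed
  then have "card (related_pairs R (F - {e}) \<union> (\<lambda>f. {e, f}) ` ?N) \<le> card (related_pairs R F)"
    by (rule card_mono[OF finite_related_pairs[OF assms(1)]])
  with card_Un show ?thesis
    by linarith
qed

lemma card_related_pairs_ge:
  fixes b :: "nat \<Rightarrow> nat"
  assumes "finite F"
    and "\<And>l G. G \<subseteq> F \<Longrightarrow> \<forall>e\<in>G. card {f \<in> G. R e f} \<le> l \<Longrightarrow> card G \<le> b l"
  shows "(\<Sum>l<m. real (card F) - real (b l)) \<le> real (card (related_pairs R F))"
  using assms
proof (induction "card F + m" arbitrary: F m rule: less_induct)
  case less
  show ?case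
  proof (cases m)
    case 0
    then show ?thesis by simp
  next
    case (Suc l)
    show ?thesis
    proof (cases "card F \<le> b l")
      case True
      have "(\<Sum>l<l. real (card F) - real (b l)) \<le> real (card (related_pairs R F))"
        using less.hyps[OF _ less.prems] Suc by simp
      with True show ?thesis by (simp add: Suc)
    next
      case False
      then have "\<not> (\<forall>e\<in>F. card {f \<in> F. R e f} \<le> l)"
        using less.prems(2)[of F l] by blast
      then obtain e where e: "e \<in> F" "m \<le> card {f \<in> F. R e f}"
        using Suc by (auto simp: not_le Suc_le_eq)
      have card: "card F = Suc (card (F - {e}))"
        using e less.prems(1) by (metis card.remove)
      have "(\<Sum>l<m. real (card (F - {e})) - real (b l)) \<le> real (card (related_pairs R (F - {e})))"
        using less.prems card by (intro less.hyps) auto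
      moreover have "(\<Sum>l<m. real (card F) - real (b l))
          = m + (\<Sum>l<m. real (card (F - {e})) - real (b l))"
        by (simp add: card algebra_simps sum.distrib sum_subtractf)
      ultimately show ?thesis
        using card_related_pairs_remove[OF less.prems(1) e(1), of R] e(2) by simp
    qed
  qed
qed

lemma card_le_max_edges:
  assumes "convex_polygon_vertices n P" "F \<subseteq> polygon_diagonals P"
    and "\<forall>e\<in>F. card {f \<in> F. segments_cross e f} \<le> l"
  shows "card F \<le> max_edges l n"
  unfolding max_edges_def
proof (rule Max_ge)
  let ?S = "{card F | F P. convex_polygon_vertices n P \<and> F \<subseteq> polygon_diagonals P \<and>
                        (\<forall>e\<in>F. card {f \<in> F. segments_cross e f} \<le> l)}"
  show "card F \<in> ?S"
    using assms by blast
  \<comment> \<open>The crude bound by the size of the power set of \<open>P\<close> serves to make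
    the set under \<open>Max\<close> finite.\<close>
  have "?S \<subseteq> {..2 ^ n}"
  proof clarsimp
    fix F P assume "convex_polygon_vertices n P" "F \<subseteq> polygon_diagonals P"
    then have "finite P" "card P = n" "F \<subseteq> Pow P"
      by (auto simp: convex_polygon_vertices_def polygon_diagonals_def)
    then show "card F \<le> 2 ^ n"
      by (metis card_Pow card_mono finite_Pow_iff)
  qed
  then show "finite ?S"
    by (rule finite_subset) simp
qed

section \<open>Polygons inscribed in a parabola\<close>

definition parab :: "real \<Rightarrow> real^2" where
  "parab t = vector [t, t\<^sup>2]"

lemma parab_nth [simp]: "parab t $ 1 = t" "parab t $ 2 = t\<^sup>2"
  by (simp_all add: parab_def)

lemma inj_parab: "inj parab"
  by (rule injI) (metis parab_nth(1))

lemma parab_eq_iff [simp]: "parab s = parab t \<longleftrightarrow> s = t"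
  using inj_parab by (auto dest: injD)

text \<open>The chord is the line y = (a + b) x - a b. Writing it as x^2 plus the height (x - a)(b -
  x) above the parabola reduces the comparison of two chords to a comparison of products.\<close>

lemma mem_open_segment_parab:
  assumes "a < b"
  shows "z \<in> open_segment (parab a) (parab b) \<longleftrightarrow>
           a < z $ 1 \<and> z $ 1 < b \<and> z $ 2 = (z $ 1)\<^sup>2 + (z $ 1 - a) * (b - z $ 1)"
proof
  assume "z \<in> open_segment (parab a) (parab b)"
  then obtain u where u: "0 < u" "u < 1" "z = (1 - u) *\<^sub>R parab a + u *\<^sub>R parab b"
    by (auto simp: in_segment)
  have z1: "z $ 1 = a + u * (b - a)" and z2: "z $ 2 = (1 - u) * a\<^sup>2 + u * b\<^sup>2"
    by (simp_all add: u(3) algebra_simps)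
  have "0 < u * (b - a)" "0 < (1 - u) * (b - a)"
    using u assms by simp_all
  then show "a < z $ 1 \<and> z $ 1 < b \<and> z $ 2 = (z $ 1)\<^sup>2 + (z $ 1 - a) * (b - z $ 1)"
    unfolding z1 z2 by (simp add: algebra_simps power2_eq_square)
next
  assume z: "a < z $ 1 \<and> z $ 1 < b \<and> z $ 2 = (z $ 1)\<^sup>2 + (z $ 1 - a) * (b - z $ 1)"
  define u where "u = (z $ 1 - a) / (b - a)"
  have u: "0 < u" "u < 1" and ub: "u * (b - a) = z $ 1 - a"
    using z assms by (auto simp: u_def field_simps)
  have z1: "z $ 1 = (1 - u) * a + u * b"
    using ub by (simp add: algebra_simps)
  have "z $ 2 = a\<^sup>2 + (z $ 1 - a) * (a + b)"
    using z by (simp add: algebra_simps power2_eq_square)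
  also have "\<dots> = (1 - u) * a\<^sup>2 + u * b\<^sup>2"
    unfolding ub[symmetric] by (simp add: algebra_simps power2_eq_square)
  finally have "z = (1 - u) *\<^sub>R parab a + u *\<^sub>R parab b"
    using z1 by (simp add: vec_eq_iff forall_2)
  then show "z \<in> open_segment (parab a) (parab b)"
    using u assms by (auto simp: in_segment)
qed

lemma open_segments_parab_meet:
  assumes "a < c" "c < b" "b < d"
  shows "open_segment (parab a) (parab b) \<inter> open_segment (parab c) (parab d) \<noteq> {}"
proof -
  \<comment> \<open>The supporting lines y = (a + b) x - a b and y = (c + d) x - c d meet at
    abscissa \<open>t\<close>.\<close>
  define s where "s = c + d - a - b"
  define t where "t = (c * d - a * b) / s"
  have s: "s > 0" using assms by (simp add: s_def)
  have st: "t * s = c * d - a * b" using s by (simp add: t_def)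
  \<comment> \<open>The two products equal \<open>t * s - c * s\<close> and
    \<open>b * s - t * s\<close>, which places \<open>t\<close> strictly between \<open>c\<close>
    and \<open>b\<close>.\<close>
  have "(c - a) * (b - c) > 0" "(b - c) * (d - b) > 0"
    using assms by simp_all
  then have "c * s < t * s" "t * s < b * s"
    unfolding st by (simp_all add: s_def algebra_simps)
  then have t: "c < t" "t < b"
    using s by simp_all
  have eq: "(t - a) * (b - t) = (t - c) * (d - t)"
    using st by (simp add: s_def algebra_simps)
  let ?z = "vector [t, t\<^sup>2 + (t - a) * (b - t)] :: real^2"
  have "?z \<in> open_segment (parab a) (parab b)"
    using assms t by (subst mem_open_segment_parab) auto
  moreover have "?z \<in> open_segment (parab c) (parab d)"
    using assms t by (subst mem_open_segment_parab) (auto simp: eq)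
  ultimately show ?thesis by blast
qed

text \<open>Nested chords do not meet: the height of a chord over the parabola decreases with the chord.\<close>

lemma open_segments_parab_nested:
  assumes "c < d" "a \<le> c" "d \<le> b" "a < c \<or> d < b"
  shows "open_segment (parab a) (parab b) \<inter> open_segment (parab c) (parab d) = {}"
proof -
  have False if "c < t" "t < d" "(t - a) * (b - t) = (t - c) * (d - t)" for t
  proof -
    have "(t - c) * (d - t) < (t - a) * (b - t)"
    \<comment> \<open>The products are compared factor by factor; the case distinction decides which
      factor is strictly smaller.\<close>
    proof (cases "a < c")
      case True
      then show ?thesis using that assms by (intro mult_less_le_imp_less) auto
    next
      case False
      then show ?thesis using that assms by (intro mult_le_less_imp_less) auto
    qed
    with that show False by simp
  qed
  then show ?thesis
    using assms by (auto simp: mem_open_segment_parab)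
qed

text \<open>Two distinct intervals that do not interlace either have disjoint interiors, which the
  abscissa of a common point excludes, or are nested, possibly with a common endpoint.\<close>

lemma interlaced_if_open_segments_parab_meet:
  assumes "a < b" "c < d" "(a, b) \<noteq> (c, d)"
    and "open_segment (parab a) (parab b) \<inter> open_segment (parab c) (parab d) \<noteq> {}"
  shows "a < c \<and> c < b \<and> b < d \<or> c < a \<and> a < d \<and> d < b"
proof -
  have "c < b" "a < d"
    using assms by (auto simp: mem_open_segment_parab)
  moreover have "\<not> (a \<le> c \<and> d \<le> b)"
    using open_segments_parab_nested[of c d a b] assms by force
  moreover have "\<not> (c \<le> a \<and> b \<le> d)"
    using open_segments_parab_nested[of a b c d] assms by (force simp: Int_commute)
  ultimately show ?thesis by linarith
qed

text \<open>The tangent at \<open>parab a\<close> separates: \<open>?H\<close> is the open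
  half-plane above it. It contains all other points of the parabola because (x - a)^2 > 0, hence
  also their hull, but not \<open>parab a\<close> itself.\<close>

lemma convex_polygon_vertices_parab:
  assumes "finite X"
  shows "convex_polygon_vertices (card X) (parab ` X)"
  unfolding convex_polygon_vertices_def
proof (intro conjI ballI)
  show "finite (parab ` X)" "card (parab ` X) = card X"
    using assms inj_parab by (auto intro: card_image inj_on_subset)
  fix p assume "p \<in> parab ` X"
  then obtain a where a: "a \<in> X" "p = parab a" by blast
  let ?S = "parab ` (X - {a})"
  let ?H = "{z :: real^2. (vector [2 * a, -1] :: real^2) \<bullet> z < a\<^sup>2}"
  have "?S \<subseteq> ?H"
  proof clarsimp
    fix x assume "x \<noteq> a"
    then have "(x - a)\<^sup>2 > 0" by simp
    then show "(vector [2 * a, -1] :: real^2) \<bullet> parab x < a\<^sup>2"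
      by (simp add: inner_vec_def sum_2 power2_eq_square algebra_simps)
  qed
  then have "convex hull ?S \<subseteq> ?H"
    by (rule hull_minimal) (rule convex_halfspace_lt)
  moreover have "parab a \<notin> ?H"
    by (simp add: inner_vec_def sum_2 power2_eq_square)
  ultimately have "parab a extreme_point_of (convex hull (insert (parab a) ?S))"
    using assms by (intro extreme_point_of_convex_hull_insert) auto
  moreover have "insert (parab a) ?S = parab ` X"
    using a by auto
  ultimately show "p extreme_point_of (convex hull (parab ` X))"
    using a by simp
qed

text \<open>The chord from \<open>w\<close> to \<open>z\<close> crosses the chord from
  \<open>a\<close> to \<open>b\<close>. A face that meets the interior of a segment of the hull
  contains its endpoints, so a side would contain \<open>parab w\<close>, yet no chord meets the
  parabola strictly between its ends.\<close>

lemma not_edge_of_parab: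
  assumes "{a, b, w, z} \<subseteq> X" "a < w" "w < b" "z < a \<or> b < z"
  shows "\<not> closed_segment (parab a) (parab b) edge_of (convex hull (parab ` X))"
proof
  assume "closed_segment (parab a) (parab b) edge_of (convex hull (parab ` X))"
  then have face: "closed_segment (parab a) (parab b) face_of (convex hull (parab ` X))"
    by (simp add: edge_of_def)
  have "open_segment (parab a) (parab b) \<inter> open_segment (parab w) (parab z) \<noteq> {}"
    using assms open_segments_parab_meet[of a w b z] open_segments_parab_meet[of z a w b]
    by (auto simp: Int_commute open_segment_commute)
  then obtain y where y: "y \<in> open_segment (parab a) (parab b)"
      "y \<in> open_segment (parab w) (parab z)"
    by blast
  have "parab w \<in> convex hull (parab ` X)" "parab z \<in> convex hull (parab ` X)"
    using assms by (auto intro: hull_inc)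
  then have "parab w \<in> closed_segment (parab a) (parab b)"
    using face_ofD[OF face y(2)] y(1) by (auto simp: open_segment_def)
  then have "parab w \<in> open_segment (parab a) (parab b)"
    using assms by (auto simp: open_segment_def)
  then have "(w - a) * (b - w) = 0"
    using assms by (simp add: mem_open_segment_parab)
  then show False using assms by simp
qed

text \<open>By \<open>not_edge_of_parab\<close>, a side cannot have vertices both between and
  outside its abscissae. Hence it joins a point to its successor or joins the two extremes, which
  leaves (card X - 1) + 1 candidates.\<close>

lemma card_parab_sides_le:
  assumes "finite X" "X \<noteq> {}"
  shows "card {e. e \<subseteq> X \<and> card e = 2 \<and> parab ` e \<notin> polygon_diagonals (parab ` X)} \<le> card X"
proof -
  let ?S = "{e. e \<subseteq> X \<and> card e = 2 \<and> parab ` e \<notin> polygon_diagonals (parab ` X)}"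
  let ?next = "\<lambda>a. {a, Min {b \<in> X. a < b}}"
  have "?S \<subseteq> insert {Min X, Max X} (?next ` (X - {Max X}))"
  proof
    fix e assume e: "e \<in> ?S"
    then obtain a b where ab: "e = {a, b}" "a < b"
      by (auto simp: card_2_iff) (metis insert_commute linorder_neqE)
    with e have X: "a \<in> X" "b \<in> X" by auto
    have edge: "closed_segment (parab a) (parab b) edge_of (convex hull (parab ` X))"
      using e ab X unfolding polygon_diagonals_def by fastforce
    show "e \<in> insert {Min X, Max X} (?next ` (X - {Max X}))"
    proof (cases "\<exists>w\<in>X. a < w \<and> w < b")
      case True
      then have "\<forall>z\<in>X. a \<le> z \<and> z \<le> b"
        using not_edge_of_parab[of a b _ _ X] edge X by (meson empty_subsetI insert_subset not_le)
      then have "a = Min X" "b = Max X"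
        using X assms by (auto intro!: Min_eqI[symmetric] Max_eqI[symmetric])
      then show ?thesis using ab by simp
    next
      case False
      then have "b = Min {b \<in> X. a < b}"
        using X ab assms by (auto intro!: Min_eqI[symmetric] simp: not_less)
      moreover have "a \<noteq> Max X"
        using X ab assms by (metis Max_ge not_le)
      ultimately show ?thesis using X ab by auto
    qed
  qed
  then have "card ?S \<le> card (insert {Min X, Max X} (?next ` (X - {Max X})))"
    using assms by (intro card_mono) auto
  also have "\<dots> \<le> Suc (card (?next ` (X - {Max X})))"
    by (rule card_insert_le_m1) auto
  also have "\<dots> \<le> Suc (card (X - {Max X}))"
    using card_image_le[of "X - {Max X}" ?next] assms(1) by blast
  also have "\<dots> = card X"
    using assms by (metis Max_in card.remove)
  finally show ?thesis .
qed

text \<open>With N = \<open>card X\<close>, removing at most N sides from the N(N - 1)/2 pairs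
  leaves at least N(N - 3)/2.\<close>

lemma card_parab_diagonals_ge:
  assumes "finite X" "X \<noteq> {}"
  shows "real (card X) * (real (card X) - 3) / 2
      \<le> card {e. e \<subseteq> X \<and> card e = 2 \<and> parab ` e \<in> polygon_diagonals (parab ` X)}"
proof -
  let ?T = "{e. e \<subseteq> X \<and> card e = 2}"
  let ?D = "{e. e \<subseteq> X \<and> card e = 2 \<and> parab ` e \<in> polygon_diagonals (parab ` X)}"
  let ?S = "{e. e \<subseteq> X \<and> card e = 2 \<and> parab ` e \<notin> polygon_diagonals (parab ` X)}"
  have fin: "finite ?T" using assms by simp
  have "card ?D + card ?S = card (?D \<union> ?S)"
    using fin by (intro card_Un_disjoint[symmetric]) (auto elim: rev_finite_subset)
  also have "?D \<union> ?S = ?T" by auto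
  also have "card ?T = card X choose 2"
    by (rule n_subsets[OF assms(1)])
  finally have "real (card ?D) + real (card ?S) = real (card X choose 2)"
    by (simp only: of_nat_add[symmetric])
  moreover have "real (card X choose 2) = real (card X) * (real (card X) - 1) / 2"
    by (cases "card X") (simp_all add: choose_two real_of_nat_div algebra_simps)
  moreover have "real (card ?S) \<le> real (card X)"
    using card_parab_sides_le[OF assms] by simp
  ultimately show ?thesis
    by (simp add: field_simps)
qed

section \<open>Arcs in a page\<close>

text \<open>Edges of a drawing carry no orientation; reversing the path if necessary gives the one
  that the Fashoda theorem expects.\<close>

lemma path_with_endpoints:
  assumes "path g" "{pathstart g, pathfinish g} = {p, q}"
  obtains h where "path h" "path_image h = path_image g" "pathstart h = p" "pathfinish h = q"
proof (cases "pathstart g = p \<and> pathfinish g = q")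
  case True
  then show ?thesis using that[of g] assms by auto
next
  case False
  then have "pathstart g = q" "pathfinish g = p"
    using assms(2) by (auto simp: doubleton_eq_iff)
  then show ?thesis
    using that[of "reversepath g"] assms by auto
qed

text \<open>Both arcs lie in a box whose bottom side is on the spine, where their endpoints
  alternate, so the Fashoda theorem gives a common point. It is interior to both arcs: the four
  endpoints lie on the spine, which arc interiors avoid, and the two endpoint sets are
  disjoint.\<close>

lemma page_arcs_cross:
  assumes f: "path f" "{pathstart f, pathfinish f} = {p, q}" "arc_interior f \<subseteq> open_page"
    and g: "path g" "{pathstart g, pathfinish g} = {r, s}" "arc_interior g \<subseteq> open_page"
    and spine: "{p, q, r, s} \<subseteq> spine"
    and order: "p $ 1 < r $ 1" "r $ 1 < q $ 1" "q $ 1 < s $ 1"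
  shows "arc_interior f \<inter> arc_interior g \<noteq> {}"
proof -
  obtain f' where f': "path f'" "path_image f' = path_image f" "pathstart f' = p" "pathfinish f' = q"
    using path_with_endpoints[OF f(1,2)] by auto
  obtain g' where g': "path g'" "path_image g' = path_image g" "pathstart g' = r" "pathfinish g' = s"
    using path_with_endpoints[OF g(1,2)] by auto
  let ?K = "path_image f \<union> path_image g"
  have "bounded ?K"
    using f(1) g(1) by (simp add: bounded_path_image)
  then obtain a b where K: "?K \<subseteq> cbox a b"
    using bounded_subset_cbox_symmetric by metis
  have nonneg: "z $ 2 \<ge> 0" if "z \<in> ?K" for z
  proof -
    have "path_image f \<subseteq> arc_interior f \<union> {p, q}" "path_image g \<subseteq> arc_interior g \<union> {r, s}"
      using f(2) g(2) by (auto simp: arc_interior_def)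
    then have "z \<in> open_page \<union> spine"
      using that f(3) g(3) spine by blast
    then show ?thesis by (auto simp: open_page_def spine_def)
  qed
  \<comment> \<open>Since no point of the arcs is below the spine, the bottom of the box may be
    moved to height 0.\<close>
  let ?a = "vector [a $ 1, 0] :: real^2"
  have "?K \<subseteq> cbox ?a b"
    using K nonneg by (auto simp: mem_box_cart forall_2 subset_iff)
  moreover have "p $ 2 = 0" "q $ 2 = 0" "r $ 2 = 0" "s $ 2 = 0"
    using spine by (auto simp: spine_def)
  ultimately obtain z where z: "z \<in> path_image f" "z \<in> path_image g"
    using fashoda_interlace[OF f'(1) g'(1), of ?a b] f' g' order by auto
  have ne: "{p, q} \<inter> {r, s} = {}" using order by auto
  have "z \<notin> {p, q}"
  proof
    assume zp: "z \<in> {p, q}"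
    with ne have "z \<in> arc_interior g"
      using z g(2) by (auto simp: arc_interior_def)
    with zp show False using g(3) spine by (auto simp: open_page_def spine_def)
  qed
  moreover have "z \<notin> {r, s}"
  proof
    assume zr: "z \<in> {r, s}"
    with ne have "z \<in> arc_interior f"
      using z f(2) by (auto simp: arc_interior_def)
    with zr show False using f(3) spine by (auto simp: open_page_def spine_def)
  qed
  ultimately have "z \<in> arc_interior f \<inter> arc_interior g"
    using z f(2) g(2) by (simp add: arc_interior_def)
  then show ?thesis by blast
qed

lemma finite_complete_edges: "finite V \<Longrightarrow> finite (complete_edges V)"
  by (simp add: complete_edges_def)

lemma book_drawing_inj_on_abscissa:
  assumes "book_drawing k V E pos pg \<gamma>"
  shows "inj_on (\<lambda>v. pos v $ 1) V"
proof (rule inj_onI)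
  fix u v assume "u \<in> V" "v \<in> V" "pos u $ 1 = pos v $ 1"
  moreover from this have "pos u $ 2 = 0" "pos v $ 2 = 0"
    using assms by (auto simp: book_drawing_def spine_def)
  ultimately have "pos u = pos v" by (simp add: vec_eq_iff forall_2)
  then show "u = v"
    using assms \<open>u \<in> V\<close> \<open>v \<in> V\<close> by (auto simp: book_drawing_def dest: inj_onD)
qed

text \<open>One direction suffices for a lower bound: arcs whose chords do not cross may still meet,
  which only adds crossings to the drawing.\<close>

lemma drawing_crossing_if_lifts_cross:
  assumes draw: "book_drawing k V (complete_edges V) pos pg \<gamma>"
    and e: "e \<in> complete_edges V" and f: "f \<in> complete_edges V" and page: "pg e = pg f"
    and cross: "segments_cross ((\<lambda>v. parab (pos v $ 1)) ` e) ((\<lambda>v. parab (pos v $ 1)) ` f)"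
  shows "\<exists>z. ({e, f}, z) \<in> drawing_crossings (complete_edges V) pg \<gamma>"
proof -
  let ?x = "\<lambda>v. pos v $ 1"
  have inj: "inj_on ?x V"
    using draw by (rule book_drawing_inj_on_abscissa)
  have ends: "\<exists>a b. e = {a, b} \<and> ?x a < ?x b \<and> a \<in> V \<and> b \<in> V" if "e \<in> complete_edges V" for e
  proof -
    from that obtain a b where ab: "e = {a, b}" "a \<noteq> b" "a \<in> V" "b \<in> V"
      by (auto simp: complete_edges_def card_2_iff)
    then have "?x a \<noteq> ?x b" using inj by (auto dest: inj_onD)
    then show ?thesis using ab by (metis insert_commute linorder_neqE)
  qed
  obtain a b where ab: "e = {a, b}" "?x a < ?x b" "a \<in> V" "b \<in> V"
    using ends[OF e] by blast
  obtain c d where cd: "f = {c, d}" "?x c < ?x d" "c \<in> V" "d \<in> V"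
    using ends[OF f] by blast
  have arcs: "path (\<gamma> e)" "{pathstart (\<gamma> e), pathfinish (\<gamma> e)} = pos ` e"
      "arc_interior (\<gamma> e) \<subseteq> open_page" if "e \<in> complete_edges V" for e
    using draw that by (auto simp: book_drawing_def arc_imp_path)
  have spine: "{pos a, pos b, pos c, pos d} \<subseteq> spine"
    using draw ab cd by (auto simp: book_drawing_def)
  from cross have ne: "e \<noteq> f"
    by (auto simp: segments_cross_def)
  have "open_segment (parab (?x a)) (parab (?x b)) \<inter> open_segment (parab (?x c)) (parab (?x d)) \<noteq> {}"
  \<comment> \<open>\<open>segments_cross\<close> fixes the endpoints only up to order, which open
    segments do not see.\<close>
  proof -
    from cross obtain p q r s where "{parab (?x a), parab (?x b)} = {p, q}"
        "{parab (?x c), parab (?x d)} = {r, s}" "open_segment p q \<inter> open_segment r s \<noteq> {}"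
      unfolding segments_cross_def ab(1) cd(1) image_insert image_empty by blast
    then show ?thesis
      by (metis doubleton_eq_iff open_segment_commute)
  qed
  moreover have "(?x a, ?x b) \<noteq> (?x c, ?x d)"
    using ne ab cd inj by (auto dest: inj_onD)
  ultimately have "?x a < ?x c \<and> ?x c < ?x b \<and> ?x b < ?x d \<or> ?x c < ?x a \<and> ?x a < ?x d \<and> ?x d < ?x b"
    using interlaced_if_open_segments_parab_meet ab(2) cd(2) by blast
  then have "arc_interior (\<gamma> e) \<inter> arc_interior (\<gamma> f) \<noteq> {}"
  proof
    assume "?x a < ?x c \<and> ?x c < ?x b \<and> ?x b < ?x d"
    then show ?thesis
      using arcs[OF e] arcs[OF f] spine ab(1) cd(1)
      by (intro page_arcs_cross[of _ "pos a" "pos b" _ "pos c" "pos d"]) auto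
  next
    assume "?x c < ?x a \<and> ?x a < ?x d \<and> ?x d < ?x b"
    then have "arc_interior (\<gamma> f) \<inter> arc_interior (\<gamma> e) \<noteq> {}"
      using arcs[OF e] arcs[OF f] spine ab(1) cd(1)
      by (intro page_arcs_cross[of _ "pos c" "pos d" _ "pos a" "pos b"]) auto
    then show ?thesis by blast
  qed
  then show ?thesis
    using e f page ne unfolding drawing_crossings_def by blast
qed

section \<open>Lower bound for a book drawing\<close>

lemma card_drawing_crossings_ge:
  assumes draw: "book_drawing k V (complete_edges V) pos pg \<gamma>"
    and V: "finite V" "V \<noteq> {}" and n: "card V = n"
  shows "real m / 2 * real n * (real n - 3) - real k * (\<Sum>l<m. real (max_edges l n))
      \<le> real (card (drawing_crossings (complete_edges V) pg \<gamma>))"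
proof -
  define x where "x v = pos v $ 1" for v
  define q where "q v = parab (x v)" for v
  define X where "X = x ` V"
  define R where "R e f = segments_cross (q ` e) (q ` f)" for e f
  define D where "D = {e \<in> complete_edges V. q ` e \<in> polygon_diagonals (parab ` X)}"
  define F where "F i = {e \<in> D. pg e = i}" for i
  let ?C = "drawing_crossings (complete_edges V) pg \<gamma>"
  have inj: "inj_on x V"
    using book_drawing_inj_on_abscissa[OF draw] unfolding x_def[abs_def] .
  then have injq: "inj_on q V"
    by (auto simp: inj_on_def q_def)
  have X: "finite X" "X \<noteq> {}" "card X = n"
    using V n inj by (auto simp: X_def card_image)
  have poly: "convex_polygon_vertices n (parab ` X)"
    using convex_polygon_vertices_parab[OF X(1)] X(3) by simp
  have finD: "finite D"
    using finite_complete_edges[OF V(1)] by (simp add: D_def)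
  have finF: "finite (F i)" for i
    using finD by (simp add: F_def)
  have injD: "inj_on ((`) q) D"
    using injq by (auto intro!: inj_onI simp: D_def complete_edges_def inj_on_image_eq_iff)
  have cardD: "real n * (real n - 3) / 2 \<le> real (card D)"
  proof -
    let ?E = "{e. e \<subseteq> X \<and> card e = 2 \<and> parab ` e \<in> polygon_diagonals (parab ` X)}"
    have "?E \<subseteq> (`) x ` D"
    proof
      fix e assume e: "e \<in> ?E"
      then obtain e' where e': "e' \<subseteq> V" "e = x ` e'"
        by (auto simp: X_def subset_image_iff)
      then have "card e' = 2"
        using e card_image[OF inj_on_subset[OF inj e'(1)]] by simp
      then have "e' \<in> D"
        using e e' by (auto simp: D_def complete_edges_def q_def image_image)
      then show "e \<in> (`) x ` D" using e' by blast
    qed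
    then have "card ?E \<le> card D"
      using surj_card_le[OF finD] by blast
    then show ?thesis
      using card_parab_diagonals_ge[OF X(1,2)] unfolding X(3) by linarith
  qed
  \<comment> \<open>On each page \<open>max_edges l n\<close> serves as the degree bound:
    \<open>q\<close> is injective on the vertices, so a family of edges and its lift have equally
    many members, and crossing counts do not grow under lifting.\<close>
  have page: "(\<Sum>l<m. real (card (F i)) - real (max_edges l n)) \<le> real (card (related_pairs R (F i)))"
    for i
  proof (rule card_related_pairs_ge[OF finF])
    fix l G assume G: "G \<subseteq> F i" and deg: "\<forall>e\<in>G. card {f \<in> G. R e f} \<le> l"
    have GD: "G \<subseteq> D" using G by (auto simp: F_def)
    have "card {f \<in> (`) q ` G. segments_cross (q ` e) f} \<le> l" if "e \<in> G" for e
    proof -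
      have "{f \<in> (`) q ` G. segments_cross (q ` e) f} = (`) q ` {f \<in> G. R e f}"
        by (auto simp: R_def)
      also have "card \<dots> \<le> card {f \<in> G. R e f}"
        using finite_subset[OF GD finD] by (intro card_image_le) simp
      finally show ?thesis using deg that by fastforce
    qed
    moreover have "(`) q ` G \<subseteq> polygon_diagonals (parab ` X)"
      using GD by (auto simp: D_def)
    ultimately have "card ((`) q ` G) \<le> max_edges l n"
      using poly by (intro card_le_max_edges) auto
    then show "card G \<le> max_edges l n"
      using card_image[OF inj_on_subset[OF injD GD]] by simp
  qed
  have finC: "finite ?C"
    using draw by (simp add: book_drawing_def)
  \<comment> \<open>Projecting to \<open>fst\<close> forgets the crossing point; a pair that meets
    several times is counted once on the left.\<close>
  have "(\<Union>i<k. related_pairs R (F i)) \<subseteq> fst ` ?C"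
  proof
    fix p assume "p \<in> (\<Union>i<k. related_pairs R (F i))"
    then obtain i e f where "p = {e, f}" "e \<in> F i" "f \<in> F i" "R e f"
      by (auto simp: related_pairs_def)
    then obtain z where "(p, z) \<in> ?C"
      using drawing_crossing_if_lifts_cross[OF draw, of e f]
      by (auto simp: F_def D_def R_def q_def[abs_def] x_def)
    then show "p \<in> fst ` ?C" by force
  qed
  then have "card (\<Union>i<k. related_pairs R (F i)) \<le> card ?C"
    using surj_card_le[OF finC] by blast
  moreover have "card (\<Union>i<k. related_pairs R (F i)) = (\<Sum>i<k. card (related_pairs R (F i)))"
  proof (rule card_UN_disjoint)
    show "\<forall>i\<in>{..<k}. \<forall>j\<in>{..<k}. i \<noteq> j \<longrightarrow> related_pairs R (F i) \<inter> related_pairs R (F j) = {}"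
      by (auto simp: related_pairs_def F_def doubleton_eq_iff)
  qed (auto simp: finite_related_pairs finF)
  ultimately have "(\<Sum>i<k. real (card (related_pairs R (F i)))) \<le> real (card ?C)"
    by (metis of_nat_le_iff of_nat_sum)
  moreover have "(\<Sum>i<k. \<Sum>l<m. real (card (F i)) - real (max_edges l n))
      \<le> (\<Sum>i<k. real (card (related_pairs R (F i))))"
    by (rule sum_mono) (rule page)
  moreover have "(\<Sum>i<k. \<Sum>l<m. real (card (F i)) - real (max_edges l n))
      = real m * (\<Sum>i<k. real (card (F i))) - real k * (\<Sum>l<m. real (max_edges l n))"
    by (simp add: sum_subtractf sum_distrib_left)
  moreover have "(\<Sum>i<k. real (card (F i))) = real (card D)"
  proof -
    have "D = (\<Union>i<k. F i)"
      using draw by (auto simp: F_def D_def book_drawing_def)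
    moreover have "card (\<Union>i<k. F i) = (\<Sum>i<k. card (F i))"
      using finF by (intro card_UN_disjoint) (auto simp: F_def)
    ultimately show ?thesis by simp
  qed
  moreover have "real m * (real n * (real n - 3) / 2) \<le> real m * real (card D)"
    using cardD by (rule mult_left_mono) simp
  ultimately show ?thesis
    by (simp add: mult.assoc)
qed

section \<open>Existence of a book drawing\<close>

text \<open>The parabola y = (x - a)(b - x) over [a, b], parametrized affinely in x. All caps have
  the same leading coefficient, so intersecting two of them is a linear problem.\<close>

definition cap :: "real \<Rightarrow> real \<Rightarrow> real \<Rightarrow> real^2" where
  "cap a b t = vector [a + t * (b - a), t * (1 - t) * (b - a)\<^sup>2]"

lemma cap_nth [simp]: "cap a b t $ 1 = a + t * (b - a)" "cap a b t $ 2 = t * (1 - t) * (b - a)\<^sup>2"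
  by (simp_all add: cap_def)

lemma arc_cap: "a < b \<Longrightarrow> arc (cap a b)"
  unfolding arc_def path_def
proof
  show "continuous_on {0..1} (cap a b)"
    unfolding continuous_on_componentwise[of _ "cap a b"]
    by (auto simp: Basis_vec_def cart_eq_inner_axis[symmetric] forall_2 intro!: continuous_intros)
  assume "a < b"
  show "inj_on (cap a b) {0..1}"
  proof (rule inj_onI)
    fix s t assume "cap a b s = cap a b t"
    then have "cap a b s $ 1 = cap a b t $ 1" by simp
    then show "s = t" using \<open>a < b\<close> by simp
  qed
qed

lemma cap_ends: "pathstart (cap a b) = vector [a, 0]" "pathfinish (cap a b) = vector [b, 0]"
  by (simp_all add: pathstart_def pathfinish_def cap_def)

lemma path_image_cap: "z \<in> path_image (cap a b) \<Longrightarrow> z $ 2 = (z $ 1 - a) * (b - z $ 1)"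
  by (auto simp: path_image_def power2_eq_square algebra_simps)

lemma arc_interior_cap: "a < b \<Longrightarrow> arc_interior (cap a b) \<subseteq> open_page"
proof
  fix z assume "a < b" "z \<in> arc_interior (cap a b)"
  then obtain t where t: "0 \<le> t" "t \<le> 1" "z = cap a b t" "z \<noteq> cap a b 0" "z \<noteq> cap a b 1"
    by (auto simp: arc_interior_def path_image_def pathstart_def pathfinish_def)
  then have "0 < t" "t < 1" by (metis less_eq_real_def)+
  then show "z \<in> open_page"
    using t \<open>a < b\<close> by (simp add: open_page_def)
qed

text \<open>Equating the two parabolas leaves x (a + b - c - d) = a b - c d. This has at most one
  solution unless sums and products of the endpoints agree, and then the two intervals
  coincide.\<close>

lemma finite_caps_Int:
  assumes "a < b" "c < d" "(a, b) \<noteq> (c, d)"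
  shows "finite (path_image (cap a b) \<inter> path_image (cap c d))"
proof -
  have sum: "a + b \<noteq> c + d" if "a * b = c * d"
  proof
    assume *: "a + b = c + d"
    have "(b - a)\<^sup>2 = (a + b)\<^sup>2 - 4 * (a * b)" "(d - c)\<^sup>2 = (c + d)\<^sup>2 - 4 * (c * d)"
      by (simp_all add: power2_eq_square algebra_simps)
    with that * have "(b - a)\<^sup>2 = (d - c)\<^sup>2" by simp
    then have "b - a = d - c" using assms by (simp add: power2_eq_iff_nonneg)
    with * assms show False by auto
  qed
  define t where "t = (a * b - c * d) / (a + b - c - d)"
  have "path_image (cap a b) \<inter> path_image (cap c d) \<subseteq> {vector [t, (t - a) * (b - t)]}"
  proof
    fix z assume "z \<in> path_image (cap a b) \<inter> path_image (cap c d)"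
    then have z: "z $ 2 = (z $ 1 - a) * (b - z $ 1)" "z $ 2 = (z $ 1 - c) * (d - z $ 1)"
      by (auto dest: path_image_cap)
    then have *: "z $ 1 * (a + b - c - d) = a * b - c * d"
      by (simp add: algebra_simps)
    then have "a + b - c - d \<noteq> 0"
      using sum by (metis add_diff_eq diff_diff_eq eq_iff_diff_eq_0 mult_zero_right)
    then have "z $ 1 = t"
      using * by (simp add: t_def field_simps)
    then show "z \<in> {vector [t, (t - a) * (b - t)]}"
      using z(1) by (simp add: vec_eq_iff forall_2)
  qed
  then show ?thesis by (rule finite_subset) simp
qed

text \<open>Ensures that the \<open>Inf\<close> in \<open>book_crossing_number\<close> is attained.
  Vertex \<open>v\<close> is placed at abscissa \<open>v\<close>, and all edges are drawn as caps on
  page 0.\<close>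

lemma book_drawing_exists:
  fixes V :: "nat set"
  assumes "finite V" "k > 0"
  shows "\<exists>pos pg \<gamma>. book_drawing k V (complete_edges V) pos pg \<gamma>"
proof -
  define pos :: "nat \<Rightarrow> real^2" where "pos v = vector [real v, 0]" for v
  define \<gamma> where "\<gamma> e = cap (real (Min e)) (real (Max e))" for e
  let ?E = "complete_edges V"
  have edge: "Min e < Max e" "e = {Min e, Max e}" if "e \<in> ?E" for e
  proof -
    from that obtain a b where "e = {a, b}" "a \<noteq> b"
      by (auto simp: complete_edges_def card_2_iff)
    then show "Min e < Max e" "e = {Min e, Max e}"
      by (auto simp: min_def max_def)
  qed
  have fin: "finite (path_image (\<gamma> e) \<inter> path_image (\<gamma> f))" if "e \<in> ?E" "f \<in> ?E" "e \<noteq> f" for e f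
  proof -
    have "(real (Min e), real (Max e)) \<noteq> (real (Min f), real (Max f))"
      using edge(2)[OF that(1)] edge(2)[OF that(2)] that(3) by auto
    then show ?thesis
      unfolding \<gamma>_def using edge(1)[OF that(1)] edge(1)[OF that(2)]
      by (intro finite_caps_Int) auto
  qed
  have "book_drawing k V ?E pos (\<lambda>_. 0) \<gamma>"
    unfolding book_drawing_def
  proof (intro conjI ballI)
    show "inj_on pos V"
    proof (rule inj_onI)
      fix u v assume "pos u = pos v"
      then have "pos u $ 1 = pos v $ 1" by simp
      then show "u = v" by (simp add: pos_def)
    qed
    show "pos ` V \<subseteq> spine"
      by (auto simp: pos_def spine_def)
    fix e assume e: "e \<in> ?E"
    show "0 < k" by fact
    show "arc (\<gamma> e)" "arc_interior (\<gamma> e) \<subseteq> open_page"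
      using edge(1)[OF e] by (simp_all add: \<gamma>_def arc_cap arc_interior_cap)
    have "{pathstart (\<gamma> e), pathfinish (\<gamma> e)} = pos ` {Min e, Max e}"
      by (simp add: \<gamma>_def cap_ends pos_def)
    with edge(2)[OF e] show "{pathstart (\<gamma> e), pathfinish (\<gamma> e)} = pos ` e"
      by simp
  next
    let ?P = "{(e, f). e \<in> ?E \<and> f \<in> ?E \<and> e \<noteq> f}"
    have "drawing_crossings ?E (\<lambda>_. 0) \<gamma>
        \<subseteq> (\<Union>(e, f)\<in>?P. {{e, f}} \<times> (path_image (\<gamma> e) \<inter> path_image (\<gamma> f)))"
      by (auto simp: drawing_crossings_def arc_interior_def)
    moreover have "finite ?P"
      by (rule finite_subset[of _ "?E \<times> ?E"]) (auto simp: finite_complete_edges assms)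
    ultimately show "finite (drawing_crossings ?E (\<lambda>_. 0) \<gamma>)"
      by (elim finite_subset) (auto intro!: finite_cartesian_product fin)
  qed
  then show ?thesis by blast
qed

theorem theorem3:
  fixes n k m :: nat
  assumes "n \<ge> 3" and "k \<ge> 3"
  shows "real (book_crossing_number k {..<n} (complete_edges {..<n}))
           \<ge> real m / 2 * real n * (real n - 3) - real k * (\<Sum>l<m. real (max_edges l n))"
proof -
  let ?S = "{card (drawing_crossings (complete_edges {..<n}) pg \<gamma>) | pos pg \<gamma>.
      book_drawing k {..<n} (complete_edges {..<n}) pos pg \<gamma>}"
  have "?S \<noteq> {}"
    using book_drawing_exists[of "{..<n}" k] assms by auto
  \<comment> \<open>A nonempty set of naturals contains its infimum, so the bound for a single
    optimal drawing is enough.\<close>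
  then have "Inf ?S \<in> ?S"
    by (rule Inf_nat_def1)
  then obtain pos pg \<gamma> where "book_drawing k {..<n} (complete_edges {..<n}) pos pg \<gamma>"
      "book_crossing_number k {..<n} (complete_edges {..<n})
        = card (drawing_crossings (complete_edges {..<n}) pg \<gamma>)"
    unfolding book_crossing_number_def by blast
  then show ?thesis
    using card_drawing_crossings_ge[of k "{..<n}" pos pg \<gamma> n m] assms(1)
    by (simp add: lessThan_empty_iff)
qed

end
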